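(* $$\int_{0}^{1}\frac{|\ln t|}{1-t}\,dt=\sum_{n=1}^{\infty}\frac{1}{n^2}=\zeta(2).$$
   Context: The integral is the (improper, equivalently Lebesgue) integral over $(0,1)$ with respect to Lebesgue measure; $\ln$ is the natural logarithm and $\zeta$ is the Riemann zeta function. *)

theory Defs
  imports "HOL-Complex_Analysis.Complex_Analysis"
begin

definition zeta_series :: "complex \<Rightarrow> complex" where
  "zeta_series s = (\<Sum>n. 1 / of_nat (Suc n) powr s)"

(* The value at the pole s = 1 carries no meaning. The continuation is determined
   uniquely on - {1}; fixing its value at 1 makes it unique as a total function. *)
definition riemann_zeta :: "complex \<Rightarrow> complex" where
  "riemann_zeta s =
     (if Re s > 1 then zeta_series s
      else (THE f. f holomorphic_on - {1} \<and> (\<forall>w. Re w > 1 \<longrightarrow> f w = zeta_series w) \<and> f 1 = 0) s)"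

end

theory Submission
  imports Defs "HOL-Real_Asymp.Real_Asymp"
begin

text \<open>
  Expanding the factor \<open>1 / (1 - t)\<close> as a geometric series turns the integrand on the open unit
  interval into the series of the nonnegative functions \<open>t ^ n * (- ln t)\<close>. Each of these has an
  elementary antiderivative and integral \<open>1 / (n + 1)\<^sup>2\<close>
  (lemma \<open>power_times_neg_ln_integral\<close>). As all terms are nonnegative and their integrals are
  summable, dominated convergence permits integration term by term, which gives both the
  integrability and the value. That the sum is the value of the zeta function at 2 is
  immediate from the Dirichlet series, since 2 lies in its half-plane of convergence.
\<close>

text \<open>
  Integration by parts gives the antiderivative
  \<open>t ^ (n+1) / (n+1)\<^sup>2 - t ^ (n+1) * ln t / (n+1)\<close>. It tends to 0 at 0,
  because a positive power dominates the logarithm, and to \<open>1 / (n+1)\<^sup>2\<close> at 1. The integrand has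
  constant sign, so the improper integral computed by these limits is a Lebesgue integral.
\<close>

lemma power_times_neg_ln_integral:
  fixes n :: nat
  shows "set_integrable lborel {0<..<1::real} (\<lambda>t. t ^ n * (- ln t))" (is ?int)
    and "(LINT t:{0<..<1::real}|lborel. t ^ n * (- ln t)) = 1 / (real (Suc n))\<^sup>2" (is ?val)
proof -
  define F where "F t = t ^ Suc n / (real (Suc n))\<^sup>2 - t ^ Suc n * ln t / real (Suc n)" for t :: real
  have deriv: "DERIV F t :> t ^ n * (- ln t)" if "0 < ereal t" "ereal t < 1" for t
  proof -
    have "t > 0" using that by simp
    then show ?thesis
      unfolding F_def
      by (auto intro!: derivative_eq_intros simp: field_simps power2_eq_square simp del: power_Suc of_nat_Suc)
         (auto simp: algebra_simps)
  qed
  have cont: "isCont (\<lambda>t. t ^ n * (- ln t)) t" if "0 < ereal t" "ereal t < 1" for t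
    using that by (auto intro!: continuous_intros)
  have nonneg: "AE t in lborel. 0 < ereal t \<longrightarrow> ereal t < 1 \<longrightarrow> 0 \<le> t ^ n * (- ln t)"
    by (auto intro!: AE_I2 mult_nonneg_nonpos)
  have "(F \<longlongrightarrow> 0) (at_right 0)"
    unfolding F_def by real_asymp
  then have lim0: "((F \<circ> real_of_ereal) \<longlongrightarrow> 0) (at_right 0)"
    by (simp add: zero_ereal_def ereal_tendsto_simps)
  have "isCont F 1"
    unfolding F_def by (auto intro!: continuous_intros)
  then have "(F \<longlongrightarrow> F 1) (at_left 1)"
    by (simp add: isCont_def filterlim_at_split)
  then have lim1: "((F \<circ> real_of_ereal) \<longlongrightarrow> 1 / (real (Suc n))\<^sup>2) (at_left 1)"
    by (simp add: F_def one_ereal_def ereal_tendsto_simps)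
  note FTC = interval_integral_FTC_nonneg[OF _ deriv cont nonneg lim0 lim1]
  have interval: "einterval 0 1 = {0<..<1::real}"
    by (auto simp: einterval_def)
  show ?int using FTC(1) by (simp add: interval)
  show ?val using FTC(2) by (simp add: interval interval_lebesgue_integral_def)
qed

lemma summable_inverse_squares: "summable (\<lambda>n. 1 / (real (Suc n))\<^sup>2)"
  using inverse_power_summable[of 2, where 'a = real]
  by (subst summable_Suc_iff) (simp add: inverse_eq_divide)

lemma riemann_zeta_2: "riemann_zeta 2 = complex_of_real (\<Sum>n. 1 / (real (Suc n))\<^sup>2)"
proof -
  have "riemann_zeta 2 = (\<Sum>n. complex_of_real (1 / (real (Suc n))\<^sup>2))"
    unfolding riemann_zeta_def zeta_series_def
    by (simp add: powr_numeral del: of_nat_Suc)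
  then show ?thesis
    using suminf_of_real[OF summable_inverse_squares] by metis
qed

theorem mainTheorem1:
  shows "set_integrable lborel {0<..<1::real} (\<lambda>t. \<bar>ln t\<bar> / (1 - t)) \<and>
         summable (\<lambda>n. 1 / (real (Suc n))\<^sup>2) \<and>
         (LINT t:{0<..<1::real}|lborel. \<bar>ln t\<bar> / (1 - t)) = (\<Sum>n. 1 / (real (Suc n))\<^sup>2) \<and>
         complex_of_real (\<Sum>n. 1 / (real (Suc n))\<^sup>2) = riemann_zeta 2"
proof -
  define f :: "nat \<Rightarrow> real \<Rightarrow> real"
    where "f = (\<lambda>n t. indicator {0<..<1} t *\<^sub>R (t ^ n * (- ln t)))"
  have f_integrable: "integrable lborel (f n)" for n
    using power_times_neg_ln_integral(1)[of n]
    by (simp add: f_def set_integrable_def)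
  have f_integral: "(\<integral>t. f n t \<partial>lborel) = 1 / (real (Suc n))\<^sup>2" for n
    using power_times_neg_ln_integral(2)[of n]
    by (simp add: f_def set_lebesgue_integral_def)
  have f_norm: "norm (f n t) = f n t" for n t
    by (auto simp: f_def indicator_def abs_mult mult_nonneg_nonpos)
  have f_sums: "(\<lambda>n. f n t) sums (indicator {0<..<1} t *\<^sub>R (\<bar>ln t\<bar> / (1 - t)))" for t
  proof (cases "t \<in> {0<..<1}")
    case True
    then have "(\<lambda>n. t ^ n * (- ln t)) sums (1 / (1 - t) * (- ln t))"
      by (intro sums_mult2 geometric_sums) auto
    then show ?thesis
      using True by (simp add: f_def)
  qed (simp add: f_def)
  have f_suminf: "(\<Sum>n. f n t) = indicator {0<..<1} t *\<^sub>R (\<bar>ln t\<bar> / (1 - t))" for t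
    using f_sums[of t] by (simp add: sums_iff)
  have "AE t in lborel. summable (\<lambda>n. norm (f n t))"
    unfolding f_norm by (intro AE_I2 sums_summable[OF f_sums])
  moreover have "summable (\<lambda>n. \<integral>t. norm (f n t) \<partial>lborel)"
    by (simp only: f_norm f_integral summable_inverse_squares)
  ultimately have
    "integrable lborel (\<lambda>t. \<Sum>n. f n t)"
    "(\<integral>t. (\<Sum>n. f n t) \<partial>lborel) = (\<Sum>n. \<integral>t. f n t \<partial>lborel)"
    by (auto intro!: integrable_suminf integral_suminf f_integrable)
  then show ?thesis
    unfolding f_suminf f_integral
    by (simp only: set_integrable_def set_lebesgue_integral_def summable_inverse_squares
        riemann_zeta_2 simp_thms)
qed

end
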